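(* Let $0<q<1$, $a<0$, $\alpha\in\mathbb R$, $N\ge0$ and $n\ge1$. Let $U_n^{(a,\alpha)}(N;x;q)$ be the monic Al-Salam-Carlitz I-Sobolev-type polynomial of degree $n$. Then $$U_n^{(a,\alpha)}(N;x;q)=(-a)^n\,\frac{B_n(x)\,(1-\varphi_n(x)q^{-1})\,q^{\binom n2-n+2}}{a\,[n]_q\,\varphi_n(x)\,(1-q)}\;{}_3\phi_2\!\left(q^{-n},x^{-1},\varphi_n(x);\,0,\varphi_n(x)q^{-1};\,q,\,a^{-1}qx\right)$$ for all $x$ for which the right-hand side is defined (i.e. $x\notin\{0,\alpha,\alpha q\}$, $B_n(x)\neq0$, $(1-q)\Theta_n(x)+1\ne0$, and $\varphi_n(x)q^{j-1}\neq1$ for $0\le j\le n-1$).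
   Context: Notation: $[z]_q=\frac{1-q^z}{1-q}$; $(b;q)_0=1$, $(b;q)_k=\prod_{j=0}^{k-1}(1-bq^j)$, $(b;q)_\infty=\prod_{j\ge0}(1-bq^j)$, $(b_1,\dots,b_r;q)_k=\prod_i(b_i;q)_k$ (also for $k=\infty$); $${}_r\phi_s(a_1,\dots,a_r;b_1,\dots,b_s;q,z)=\sum_{k\ge0}\frac{(a_1,\dots,a_r;q)_k}{(b_1,\dots,b_s;q)_k}\big((-1)^kq^{\binom k2}\big)^{1+s-r}\frac{z^k}{(q;q)_k},$$ which for $a_1=q^{-n}$ is the finite sum over $0\le k\le n$. $(\mathscr D_qf)(x)=\frac{f(qx)-f(x)}{(q-1)x}$ for $x\ne0$, $(\mathscr D_qf)(0)=f'(0)$. For $a<0$, $\int_a^1f(x)\,d_qx=(1-q)\sum_{k\ge0}f(q^k)q^k-a(1-q)\sum_{k\ge0}f(aq^k)q^k$. The monic Al-Salam-Carlitz I polynomials are $U_n^{(a)}(x;q)=(-a)^nq^{\binom n2}\,{}_2\phi_1(q^{-n},x^{-1};0;q,a^{-1}qx)$ for $n\ge0$, with $U_{-1}^{(a)}=0$; they are orthogonal with respect to $\langle{\bf u},f\rangle=\int_a^1f(x)(qx,a^{-1}qx;q)_\infty d_qx$, with $\|U_n^{(a)}\|^2=\langle{\bf u},(U_n^{(a)})^2\rangle=(1-q)(-a)^nq^{\binom n2}(q;q)_n(q,a,a^{-1}q;q)_\infty$. The polynomials $U_n^{(a,\alpha)}(N;x;q)$ are the monic polynomials of degree $n$ orthogonal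 with respect to $\langle f,g\rangle_S=\langle{\bf u},fg\rangle+N(\mathscr D_qf)(\alpha)(\mathscr D_qg)(\alpha)$. Put $\mathscr K_{q,n}^{(1,1)}(\alpha,\alpha)=\sum_{k=0}^{n-1}\frac{((\mathscr D_qU_k^{(a)})(\alpha;q))^2}{\|U_k^{(a)}\|^2}$, $$A_n(x)=1-\frac{N[n]_qU_{n-1}^{(a)}(\alpha;q)\left(U_{n-1}^{(a)}(\alpha;q)+(x-\alpha)[n-1]_qU_{n-2}^{(a)}(\alpha;q)\right)}{\|U_{n-1}^{(a)}\|^2(x-\alpha)(x-\alpha q)\left(1+N\mathscr K_{q,n}^{(1,1)}(\alpha,\alpha)\right)},$$ $$B_n(x)=\frac{N[n]_qU_{n-1}^{(a)}(\alpha;q)\left(U_n^{(a)}(\alpha;q)+(x-\alpha)[n]_qU_{n-1}^{(a)}(\alpha;q)\right)}{\|U_{n-1}^{(a)}\|^2(x-\alpha)(x-\alpha q)\left(1+N\mathscr K_{q,n}^{(1,1)}(\alpha,\alpha)\right)},$$ $$\Theta_n(x)=\frac{aq^{n-2}[n]_qA_n(x)}{B_n(x)}-[n-1]_q,\qquad \varphi_n(x)=\frac1{(1-q)\Theta_n(x)+1}.$$ *)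

theory Defs
  imports "HOL-Analysis.Analysis" "HOL-Computational_Algebra.Polynomial"
begin

definition qnum :: "real \<Rightarrow> int \<Rightarrow> real" where
  "qnum q m = (1 - q powi m) / (1 - q)"

definition qpoch :: "real \<Rightarrow> real \<Rightarrow> nat \<Rightarrow> real" where
  "qpoch b q k = (\<Prod>j<k. 1 - b * q ^ j)"

definition qpoch_inf :: "real \<Rightarrow> real \<Rightarrow> real" where
  "qpoch_inf b q = (\<Prod>j. 1 - b * q ^ j)"

definition qpochs :: "real list \<Rightarrow> real \<Rightarrow> nat \<Rightarrow> real" where
  "qpochs bs q k = (\<Prod>b\<leftarrow>bs. qpoch b q k)"

definition qpochs_inf :: "real list \<Rightarrow> real \<Rightarrow> real" where
  "qpochs_inf bs q = (\<Prod>b\<leftarrow>bs. qpoch_inf b q)"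

text \<open>The basic hypergeometric series, with \<open>r = length as\<close> and \<open>s = length bs\<close>. If
  some upper parameter is \<open>q\<^sup>-\<^sup>n\<close>, all terms with \<open>k > n\<close> have a vanishing numerator, and since
  \<open>0 / 0 = 0\<close> this is the finite sum over \<open>k \<le> n\<close> even when a lower parameter makes the
  denominator vanish for some \<open>k > n\<close>.\<close>

definition qhyp :: "real list \<Rightarrow> real list \<Rightarrow> real \<Rightarrow> real \<Rightarrow> real" where
  "qhyp as bs q z =
     (\<Sum>k. qpochs as q k / qpochs bs q k
        * ((-1) ^ k * q ^ (k choose 2)) powi (1 + int (length bs) - int (length as))
        * (z ^ k / qpoch q q k))"

definition qderiv :: "real \<Rightarrow> (real \<Rightarrow> real) \<Rightarrow> real \<Rightarrow> real" where
  "qderiv q f x = (if x = 0 then deriv f 0 else (f (q * x) - f x) / ((q - 1) * x))"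

text \<open>The Jackson integral of \<open>f\<close> from \<open>a\<close> to \<open>1\<close>.\<close>

definition qintegral :: "real \<Rightarrow> real \<Rightarrow> (real \<Rightarrow> real) \<Rightarrow> real" where
  "qintegral q a f =
     (1 - q) * (\<Sum>k. f (q ^ k) * q ^ k) - a * (1 - q) * (\<Sum>k. f (a * q ^ k) * q ^ k)"

definition asc_functional :: "real \<Rightarrow> real \<Rightarrow> (real \<Rightarrow> real) \<Rightarrow> real" where
  "asc_functional q a f = qintegral q a (\<lambda>x. f x * qpochs_inf [q * x, q * x / a] q)"

text \<open>The monic Al-Salam--Carlitz I polynomial of degree \<open>m\<close>, and \<open>0\<close> for negative \<open>m\<close>. The
  factor \<open>x ^ k * qpoch (1 / x) q k\<close> of the defining \<open>2\<phi>1\<close>-series is expanded to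
  \<open>\<Prod>j<k. x - q ^ j\<close>, so that the value at \<open>x = 0\<close> is the right one; for \<open>x \<noteq> 0\<close> see
  \<open>poly_asc_eq_qhyp\<close> below.\<close>

definition asc :: "real \<Rightarrow> real \<Rightarrow> int \<Rightarrow> real poly" where
  "asc q a m = (if m < 0 then 0 else
     smult ((-a) ^ nat m * q ^ (nat m choose 2))
       (\<Sum>k\<le>nat m. smult (qpoch (q powi (- m)) q k / qpoch q q k * (q / a) ^ k)
          (\<Prod>j<k. [:- (q ^ j), 1:])))"

definition asc_norm2 :: "real \<Rightarrow> real \<Rightarrow> int \<Rightarrow> real" where
  "asc_norm2 q a m = asc_functional q a (\<lambda>x. (poly (asc q a m) x)\<^sup>2)"

definition sobolev_inner ::
  "real \<Rightarrow> real \<Rightarrow> real \<Rightarrow> real \<Rightarrow> (real \<Rightarrow> real) \<Rightarrow> (real \<Rightarrow> real) \<Rightarrow> real" where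
  "sobolev_inner q a \<alpha> N f g =
     asc_functional q a (\<lambda>x. f x * g x) + N * qderiv q f \<alpha> * qderiv q g \<alpha>"

definition monic_orthogonal ::
  "((real \<Rightarrow> real) \<Rightarrow> (real \<Rightarrow> real) \<Rightarrow> real) \<Rightarrow> (nat \<Rightarrow> real poly) \<Rightarrow> bool" where
  "monic_orthogonal ip P \<longleftrightarrow>
     (\<forall>n. degree (P n) = n \<and> lead_coeff (P n) = 1) \<and>
     (\<forall>m n. m \<noteq> n \<longrightarrow> ip (poly (P m)) (poly (P n)) = 0)"

definition asc_sobolev :: "real \<Rightarrow> real \<Rightarrow> real \<Rightarrow> real \<Rightarrow> nat \<Rightarrow> real poly" where
  "asc_sobolev q a \<alpha> N = (THE P. monic_orthogonal (sobolev_inner q a \<alpha> N) P)"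

definition asc_kernel11 :: "real \<Rightarrow> real \<Rightarrow> nat \<Rightarrow> real \<Rightarrow> real" where
  "asc_kernel11 q a n \<alpha> =
     (\<Sum>k<n. (qderiv q (poly (asc q a (int k))) \<alpha>)\<^sup>2 / asc_norm2 q a (int k))"

definition sob_A :: "real \<Rightarrow> real \<Rightarrow> real \<Rightarrow> real \<Rightarrow> nat \<Rightarrow> real \<Rightarrow> real" where
  "sob_A q a \<alpha> N n x = (let U = (\<lambda>m. poly (asc q a m) \<alpha>) in
     1 - N * qnum q (int n) * U (int n - 1)
           * (U (int n - 1) + (x - \<alpha>) * qnum q (int n - 1) * U (int n - 2))
         / (asc_norm2 q a (int n - 1) * (x - \<alpha>) * (x - \<alpha> * q)
              * (1 + N * asc_kernel11 q a n \<alpha>)))"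

definition sob_B :: "real \<Rightarrow> real \<Rightarrow> real \<Rightarrow> real \<Rightarrow> nat \<Rightarrow> real \<Rightarrow> real" where
  "sob_B q a \<alpha> N n x = (let U = (\<lambda>m. poly (asc q a m) \<alpha>) in
     N * qnum q (int n) * U (int n - 1)
       * (U (int n) + (x - \<alpha>) * qnum q (int n) * U (int n - 1))
     / (asc_norm2 q a (int n - 1) * (x - \<alpha>) * (x - \<alpha> * q)
          * (1 + N * asc_kernel11 q a n \<alpha>)))"

definition sob_Theta :: "real \<Rightarrow> real \<Rightarrow> real \<Rightarrow> real \<Rightarrow> nat \<Rightarrow> real \<Rightarrow> real" where
  "sob_Theta q a \<alpha> N n x =
     a * q powi (int n - 2) * qnum q (int n) * sob_A q a \<alpha> N n x / sob_B q a \<alpha> N n x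
       - qnum q (int n - 1)"

definition sob_phi :: "real \<Rightarrow> real \<Rightarrow> real \<Rightarrow> real \<Rightarrow> nat \<Rightarrow> real \<Rightarrow> real" where
  "sob_phi q a \<alpha> N n x = 1 / ((1 - q) * sob_Theta q a \<alpha> N n x + 1)"

lemma qpoch_neg_power_eq_0:
  assumes "q \<noteq> 0" "k > n"
  shows "qpoch (q powi (- int n)) q k = 0"
proof -
  have "1 - q powi (- int n) * q ^ n = 0"
    using assms(1) by (simp add: power_int_minus)
  then show ?thesis
    unfolding qpoch_def using assms(2) by (intro prod_zero) auto
qed

lemma poly_asc_eq_qhyp:
  assumes "0 < q" "x \<noteq> 0"
  shows "poly (asc q a (int n)) x =
    (-a) ^ n * q ^ (n choose 2) * qhyp [q powi (- int n), 1 / x] [0] q (q * x / a)"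
proof -
  have expand: "(\<Prod>j<k. x - q ^ j) = x ^ k * qpoch (1 / x) q k" for k
  proof -
    have "(\<Prod>j<k. x - q ^ j) = (\<Prod>j<k. x * (1 - 1 / x * q ^ j))"
      using assms(2) by (intro prod.cong) (auto simp: field_simps)
    then show ?thesis by (simp add: prod.distrib qpoch_def)
  qed
  have "qhyp [q powi (- int n), 1 / x] [0] q (q * x / a)
    = (\<Sum>k. qpoch (q powi (- int n)) q k * qpoch (1 / x) q k * ((q * x / a) ^ k / qpoch q q k))"
    by (simp add: qhyp_def qpochs_def qpoch_def[of 0])
  also have "\<dots> = (\<Sum>k\<le>n. qpoch (q powi (- int n)) q k * qpoch (1 / x) q k
      * ((q * x / a) ^ k / qpoch q q k))"
    using assms(1) by (intro suminf_finite) (auto simp: qpoch_neg_power_eq_0)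
  also have "\<dots> = (\<Sum>k\<le>n. qpoch (q powi (- int n)) q k / qpoch q q k * (q / a) ^ k
      * (\<Prod>j<k. x - q ^ j))"
    by (intro sum.cong) (auto simp: expand power_mult_distrib power_divide mult_ac)
  finally show ?thesis
    by (simp add: asc_def poly_sum poly_prod)
qed

end

theory Submission
  imports Defs
begin

text \<open>The polynomial \<open>asc_sobolev q a \<alpha> N n\<close> is a combination \<open>A U n + B U (n - 1)\<close> of two consecutive
  Al-Salam--Carlitz polynomials with rational coefficients \<open>A\<close>, \<open>B\<close>, and such a combination is a
  single \<open>3\<phi>2\<close>-series.

  The combination arises because the Sobolev inner product is a rank-one perturbation
  of \<open>\<langle>u, f g\<rangle>\<close>. Correcting \<open>U n\<close> by a multiple of the q-differentiated reproducing kernel makes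
  it orthogonal to all polynomials of lower degree (\<open>sobolev_poly_orthogonal_U\<close>), and monic
  orthogonal polynomials of a positive definite form are unique (\<open>monic_orthogonal_unique\<close>). The
  q-derivative of the Christoffel--Darboux formula then writes the kernel through \<open>U n\<close> and
  \<open>U (n - 1)\<close> (\<open>kernel01_closed_form\<close>, \<open>sobolev_connection\<close>).

  This needs the classical theory of the \<open>U n\<close>. From the explicit expansion two relations for
  the coefficients are read off, a q-Pascal rule and a lowering relation; they give the three-term
  recurrence and \<open>D U n = [n] U (n - 1)\<close>. The functional satisfies a Pearson
  equation, because the Jackson integral of a q-derivative telescopes (\<open>L_pearson\<close>). Together
  with the recurrence it yields \<open>L (U n) = 0\<close> for \<open>n > 0\<close>, and from there orthogonality and the
  ratio of consecutive norms. Positivity of the weight at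
  the nodes makes the form positive definite.

  For the series, the \<open>k\<close>-th coefficient of \<open>U (n - 1)\<close> is that of \<open>U n\<close> times a linear function
  of \<open>q^k\<close> (\<open>U_coeff_ascend\<close>). So \<open>A U n + B U (n - 1)\<close> is the series of \<open>U n\<close> with such a factor
  inserted, and \<open>\<phi>\<close> is the number for which this factor is proportional to \<open>1 - \<phi> q^(k-1)\<close>, that
  is, to \<open>(\<phi>; q)_k / (\<phi>/q; q)_k\<close> (\<open>qhyp_3phi2\<close>).\<close>

section \<open>Infinite q-shifted factorials\<close>

lemma convergent_prod_qpoch:
  assumes "0 < q" "q < 1"
  shows "convergent_prod (\<lambda>j. 1 - b * q ^ j :: real)"
proof -
  have "summable (\<lambda>j. norm ((1 - b * q ^ j) - 1))"
    using assms by (auto simp: abs_mult power_abs intro!: summable_mult summable_geometric)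
  then show ?thesis
    using abs_convergent_prod_conv_summable abs_convergent_prod_imp_convergent_prod by blast
qed

lemma has_prod_qpoch_inf:
  assumes "0 < q" "q < 1"
  shows "(\<lambda>j. 1 - b * q ^ j) has_prod qpoch_inf b q"
  unfolding qpoch_inf_def using convergent_prod_qpoch[OF assms] by (rule convergent_prod_has_prod)

lemma qpoch_inf_shift:
  assumes "0 < q" "q < 1"
  shows "qpoch_inf b q = qpoch b q k * qpoch_inf (b * q ^ k) q"
proof -
  have "(\<lambda>j. 1 - b * q ^ j) has_prod (qpoch b q k * (\<Prod>j. 1 - b * q ^ (j + k)))"
    unfolding qpoch_def using convergent_prod_qpoch[OF assms] by (rule has_prod_ignore_initial_segment')
  moreover have "(\<lambda>j. 1 - b * q ^ (j + k)) = (\<lambda>j. 1 - b * q ^ k * q ^ j)"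
    by (auto simp: power_add mult_ac)
  ultimately show ?thesis
    using has_prod_qpoch_inf[OF assms, of b] by (simp add: qpoch_inf_def has_prod_unique2)
qed

lemma qpoch_inf_head:
  assumes "0 < q" "q < 1"
  shows "qpoch_inf b q = (1 - b) * qpoch_inf (b * q) q"
  using qpoch_inf_shift[OF assms, of b 1] by (simp add: qpoch_def)

lemma one_minus_mult_power_pos:
  fixes b q :: real
  assumes "0 < q" "q < 1" "b < 1"
  shows "0 < 1 - b * q ^ j"
proof (cases "b \<le> 0")
  case True
  then have "b * q ^ j \<le> 0"
    using assms by (simp add: mult_nonpos_nonneg)
  then show ?thesis by linarith
next
  case False
  then have "b * q ^ j \<le> b"
    using assms by (simp add: mult_left_le power_le_one)
  then show ?thesis using assms by linarith
qed

lemma qpoch_pos: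
  assumes "0 < q" "q < 1" "b < 1"
  shows "0 < qpoch b q k"
  unfolding qpoch_def using one_minus_mult_power_pos[OF assms] by (intro prod_pos) auto

lemma qpoch_inf_pos:
  assumes "0 < q" "q < 1" "b < 1"
  shows "0 < qpoch_inf b q"
  using has_prod_qpoch_inf[OF assms(1,2), of b] one_minus_mult_power_pos[OF assms]
  by (meson has_prod_pos)

lemma qpoch_inf_tail_tendsto_1:
  assumes "0 < q" "q < 1" "b < 1"
  shows "(\<lambda>k. qpoch_inf (b * q ^ k) q) \<longlonglongrightarrow> 1"
proof -
  have "(\<lambda>k. qpoch b q k) \<longlonglongrightarrow> qpoch_inf b q"
    unfolding qpoch_def using has_prod_qpoch_inf[OF assms(1,2)] by (rule has_prod_imp_tendsto')
  then have "(\<lambda>k. qpoch_inf b q / qpoch b q k) \<longlonglongrightarrow> qpoch_inf b q / qpoch_inf b q"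
    using qpoch_inf_pos[OF assms] by (intro tendsto_intros) auto
  moreover have "qpoch_inf b q / qpoch b q k = qpoch_inf (b * q ^ k) q" for k
    using qpoch_inf_shift[OF assms(1,2), of b k] qpoch_pos[OF assms, of k] by simp
  ultimately show ?thesis
    using qpoch_inf_pos[OF assms] by simp
qed

lemma qpoch_rec_left: "qpoch b q (Suc k) = (1 - b) * qpoch (b * q) q k"
  unfolding qpoch_def by (subst prod.lessThan_Suc_shift) (simp add: mult_ac)

lemma qpoch_Suc: "qpoch b q (Suc k) = qpoch b q k * (1 - b * q ^ k)"
  by (simp add: qpoch_def)

section \<open>The q-derivative on polynomials\<close>

lemma qderiv_poly:
  "qderiv q (poly p) x =
    (if x = 0 then poly (pderiv p) 0 else (poly p (q * x) - poly p x) / ((q - 1) * x))"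
  unfolding qderiv_def by (simp add: DERIV_imp_deriv[OF poly_DERIV])

lemma qderiv_poly_add:
  "qderiv q (poly (p + r)) x = qderiv q (poly p) x + qderiv q (poly r) x"
  by (auto simp: qderiv_poly pderiv_add add_divide_distrib diff_divide_distrib)

lemma qderiv_poly_smult: "qderiv q (poly (smult c p)) x = c * qderiv q (poly p) x"
  by (auto simp: qderiv_poly pderiv_smult right_diff_distrib)

lemma qderiv_poly_diff:
  "qderiv q (poly (p - r)) x = qderiv q (poly p) x - qderiv q (poly r) x"
  by (auto simp: qderiv_poly pderiv_diff diff_divide_distrib)

lemma qderiv_poly_sum:
  "qderiv q (poly (\<Sum>i\<in>I. p i)) x = (\<Sum>i\<in>I. qderiv q (poly (p i)) x)"
proof (induction I rule: infinite_finite_induct)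
  case (insert i I)
  then show ?case by (simp add: qderiv_poly_add del: poly_add)
qed (simp_all add: qderiv_def)

text \<open>The difference quotient of \<open>p\<close> is a polynomial \<open>r\<close> also at \<open>0\<close>: differentiating the
  polynomial identity for \<open>p\<close> and \<open>r\<close> there shows that \<open>r 0\<close> is the ordinary derivative, which
  is what the q-derivative takes as its value at \<open>0\<close>.\<close>

lemma qderiv_poly_eqI:
  assumes "q \<noteq> 1" "\<And>y. poly p (q * y) - poly p y = (q - 1) * y * poly r y"
  shows "qderiv q (poly p) x = poly r x"
proof (cases "x = 0")
  case True
  have "((\<lambda>y. poly p (q * y) - poly p y) has_real_derivative
      poly (pderiv p) (q * 0) * q - poly (pderiv p) 0) (at 0)"
    by (auto intro!: derivative_eq_intros poly_DERIV)
  moreover have "((\<lambda>y. (q - 1) * y * poly r y) has_real_derivative (q - 1) * poly r 0) (at 0)"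
    by (auto intro!: derivative_eq_intros poly_DERIV)
  ultimately have "poly (pderiv p) 0 * q - poly (pderiv p) 0 = (q - 1) * poly r 0"
    using assms(2) by (simp add: DERIV_unique)
  then have "(q - 1) * poly (pderiv p) 0 = (q - 1) * poly r 0"
    by (simp add: algebra_simps)
  then show ?thesis
    using True assms(1) by (simp add: qderiv_poly)
next
  case False
  then show ?thesis
    using assms by (simp add: qderiv_poly)
qed

text \<open>The q-Leibniz rule \<open>D(f g)(x) = f(q x) D g(x) + g(x) D f(x)\<close> for the linear factor
  \<open>f(y) = z - y\<close>.\<close>

lemma qderiv_poly_linear_mult:
  assumes "q \<noteq> 1"
  shows "qderiv q (poly ([:z, -1:] * p)) x = (z - q * x) * qderiv q (poly p) x - poly p x"
proof (cases "x = 0")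
  case True
  then show ?thesis
    by (simp add: qderiv_poly pderiv_add pderiv_smult pderiv_minus pderiv_pCons)
next
  case False
  have "poly ([:z, -1:] * p) (q * x) - poly ([:z, -1:] * p) x
      = (z - q * x) * (poly p (q * x) - poly p x) - (q - 1) * x * poly p x"
    by (simp add: algebra_simps)
  also have "\<dots> / ((q - 1) * x) = (z - q * x) * ((poly p (q * x) - poly p x) / ((q - 1) * x)) - poly p x"
    using False assms by (simp add: diff_divide_distrib[of "(z - q * x) * _"])
  finally show ?thesis
    using False unfolding qderiv_poly by simp
qed

section \<open>Monic orthogonal sequences of polynomials\<close>

text \<open>A monic sequence with \<open>degree (P n) = n\<close> is a triangular basis, so \<open>P 0, ..., P (n - 1)\<close>
  span the polynomials of degree below \<open>n\<close>, the zero polynomial included; the coefficient form of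
  this degree bound covers \<open>n = 0\<close> as well.\<close>

lemma linear_vanishes_below_degree:
  fixes P :: "nat \<Rightarrow> real poly" and l :: "real poly \<Rightarrow> real"
  assumes monic: "\<And>n. degree (P n) = n \<and> coeff (P n) n = 1"
    and add: "\<And>p r. l (p + r) = l p + l r" and smult: "\<And>c p. l (smult c p) = c * l p"
  shows "(\<And>m. m < n \<Longrightarrow> l (P m) = 0) \<Longrightarrow> (\<And>i. i \<ge> n \<Longrightarrow> coeff r i = 0) \<Longrightarrow> l r = 0"
proof (induction n arbitrary: r)
  case 0
  then have "r = 0" by (simp add: poly_eq_iff)
  then show ?case using smult[of 0 0] by simp
next
  case (Suc n)
  define s where "s = r - smult (coeff r n) (P n)"
  have "coeff s i = 0" if "i \<ge> n" for i
  proof (cases "i = n")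
    case True
    then show ?thesis using monic[of n] by (simp add: s_def)
  next
    case False
    then have "coeff (P n) i = 0"
      using that monic[of n] by (intro coeff_eq_0) auto
    then show ?thesis using that False Suc.prems(2)[of i] by (simp add: s_def)
  qed
  then have "l s = 0"
    using Suc.IH Suc.prems(1) by simp
  moreover have "l (P n) = 0"
    using Suc.prems(1) by simp
  moreover have "l r = l s + coeff r n * l (P n)"
    by (subst smult[symmetric], subst add[symmetric]) (simp add: s_def)
  ultimately show ?case by simp
qed

text \<open>Two monic polynomials of degree \<open>n\<close> that are both orthogonal to everything of lower degree
  differ by a polynomial of lower degree that is orthogonal to itself.\<close>

lemma monic_orthogonal_unique:
  fixes ip :: "(real \<Rightarrow> real) \<Rightarrow> (real \<Rightarrow> real) \<Rightarrow> real"
  assumes add: "\<And>p r s. ip (poly (p + r)) (poly s) = ip (poly p) (poly s) + ip (poly r) (poly s)"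
    and smult: "\<And>c p s. ip (poly (smult c p)) (poly s) = c * ip (poly p) (poly s)"
    and sym: "\<And>p r. ip (poly p) (poly r) = ip (poly r) (poly p)"
    and pos: "\<And>p. p \<noteq> 0 \<Longrightarrow> ip (poly p) (poly p) > 0"
    and P: "monic_orthogonal ip P" and Q: "monic_orthogonal ip Q"
  shows "P = Q"
proof
  fix n
  have monic: "degree (P n) = n \<and> coeff (P n) n = 1" "degree (Q n) = n \<and> coeff (Q n) n = 1" for n
    using P Q unfolding monic_orthogonal_def by metis+
  define r where "r = P n - Q n"
  have low: "coeff r i = 0" if "i \<ge> n" for i
  proof (cases "i = n")
    case True
    then show ?thesis using monic[of n] by (simp add: r_def)
  next
    case False
    then show ?thesis using that monic[of n] by (simp add: r_def coeff_eq_0)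
  qed
  have "ip (poly r) (poly (P n)) = 0"
    using low P
    by (intro linear_vanishes_below_degree[of P "\<lambda>p. ip (poly p) (poly (P n))" n r] monic add smult)
       (auto simp: monic_orthogonal_def)
  moreover have "ip (poly r) (poly (Q n)) = 0"
    using low Q
    by (intro linear_vanishes_below_degree[of Q "\<lambda>p. ip (poly p) (poly (Q n))" n r] monic add smult)
       (auto simp: monic_orthogonal_def)
  moreover have "ip (poly r) (poly r) = ip (poly (P n)) (poly r) - ip (poly (Q n)) (poly r)"
    using add[of "P n" "smult (-1) (Q n)" r] smult[of "-1" "Q n" r] by (simp add: r_def)
  ultimately have "ip (poly r) (poly r) = 0"
    using sym by simp
  then have "r = 0" using pos[of r] by auto
  then show "P n = Q n" by (simp add: r_def)
qed

section \<open>The Al-Salam--Carlitz I polynomials\<close>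

lemma smult_sum_right: "smult c (\<Sum>i\<in>I. p i) = (\<Sum>i\<in>I. smult c (p i))"
  by (induction I rule: infinite_finite_induct) (auto simp: smult_add_right)

locale al_salam_carlitz =
  fixes q a :: real
  assumes q_pos: "0 < q" and q_less_1: "q < 1" and a_neg: "a < 0"
begin

definition U :: "nat \<Rightarrow> real poly" where
  "U n = asc q a (int n)"

text \<open>The Al-Salam--Carlitz polynomials are expanded in these products because both operations that
  matter are of two-term or one-term form on them: multiplication by \<open>x\<close>
  (\<open>shifted_basis_Suc\<close>) and the q-derivative (\<open>shifted_basis_qdiff\<close>).\<close>

definition shifted_basis :: "nat \<Rightarrow> real poly" where
  "shifted_basis k = (\<Prod>j<k. [:- (q ^ j), 1:])"

definition U_coeff :: "nat \<Rightarrow> nat \<Rightarrow> real" where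
  "U_coeff n k = (-a) ^ n * q ^ (n choose 2) *
     (qpoch (q powi (- int n)) q k / qpoch q q k * (q / a) ^ k)"

lemma U_expansion: "U n = (\<Sum>k\<le>n. smult (U_coeff n k) (shifted_basis k))"
  by (simp add: U_def asc_def U_coeff_def shifted_basis_def smult_sum_right ac_simps)

lemma qpoch_q_nonzero [simp]: "qpoch q q k \<noteq> 0"
  using qpoch_pos[OF q_pos q_less_1 q_less_1, of k] by simp

lemma q_power_neq_1: "q ^ Suc k \<noteq> 1"
  using q_pos q_less_1 by (metis less_irrefl power_Suc_less_one)

lemma U_coeff_beyond: "n < k \<Longrightarrow> U_coeff n k = 0"
  using q_pos by (simp add: U_coeff_def qpoch_neg_power_eq_0)

lemma U_coeff_0: "U_coeff (Suc n) 0 = - a * q ^ n * U_coeff n 0"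
  by (simp add: U_coeff_def qpoch_def numeral_2_eq_2 power_add)

lemma q_powi_minus: "q powi (- int m) = 1 / q ^ m"
  by (simp add: power_int_minus divide_inverse)

text \<open>On coefficients this is the lowering relation \<open>D U (n + 1) = [n + 1] U n\<close>. It comes from
  \<open>(b/q; q)_(k+1) = (1 - b/q) (b; q)_k\<close> at \<open>b = q^-n\<close>.\<close>

lemma U_coeff_descend:
  "(1 - q ^ Suc k) * U_coeff (Suc n) (Suc k) = (1 - q ^ Suc n) * U_coeff n k"
proof -
  have alg: "D * ((-a) ^ Suc n * q ^ (n + c) * ((- E / (q * q ^ n) * Q) / (R * D) * (q / a) ^ Suc k))
      = E * ((-a) ^ n * q ^ c * (Q / R * (q / a) ^ k))"
    if "D \<noteq> 0" "R \<noteq> 0" for D E Q R :: real and c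
    using that q_pos a_neg by (simp add: field_simps power_add)
  have "qpoch (q powi (- int (Suc n))) q (Suc k)
      = (1 - q powi (- int (Suc n))) * qpoch (q powi (- int n)) q k"
    unfolding q_powi_minus using q_pos by (simp add: qpoch_rec_left)
  moreover have "1 - q powi (- int (Suc n)) = - (1 - q ^ Suc n) / (q * q ^ n)"
    unfolding q_powi_minus using q_pos by (simp add: field_simps)
  ultimately have numer: "qpoch (q powi (- int (Suc n))) q (Suc k)
      = - (1 - q ^ Suc n) / (q * q ^ n) * qpoch (q powi (- int n)) q k"
    by simp
  have denom: "qpoch q q (Suc k) = qpoch q q k * (1 - q ^ Suc k)"
    by (simp add: qpoch_Suc)
  have expo: "(Suc n choose 2) = n + (n choose 2)"
    by (simp add: numeral_2_eq_2)
  show ?thesis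
    unfolding U_coeff_def numer denom expo using q_power_neq_1[of k] by (intro alg) auto
qed

text \<open>This is the q-Pascal rule for \<open>U_coeff n k\<close>, the q-binomial coefficient times
  \<open>(-a) ^ (n - k) * q ^ ((n - k) choose 2)\<close>: the extra factor makes the coefficient
  on the right independent of \<open>k\<close>.\<close>

lemma U_coeff_pascal: "U_coeff (Suc n) (Suc k) = U_coeff n k - a * q ^ n * U_coeff n (Suc k)"
proof -
  have alg: "D * (a * q ^ n * (A * (Q * (1 - q ^ k / q ^ n) / (R * D) * (q / a) ^ Suc k)))
      = q * (q ^ n - q ^ k) * (A * (Q / R * (q / a) ^ k))"
    if "D \<noteq> 0" "R \<noteq> 0" for A D Q R :: real
    using that q_pos a_neg by (simp add: field_simps)
  have numer: "qpoch (q powi (- int n)) q (Suc k)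
      = qpoch (q powi (- int n)) q k * (1 - q ^ k / q ^ n)"
    by (simp add: qpoch_Suc q_powi_minus)
  have denom: "qpoch q q (Suc k) = qpoch q q k * (1 - q ^ Suc k)"
    by (simp add: qpoch_Suc)
  have "(1 - q ^ Suc k) * (a * q ^ n * U_coeff n (Suc k)) = q * (q ^ n - q ^ k) * U_coeff n k"
    unfolding U_coeff_def numer denom using q_power_neq_1[of k] by (intro alg) auto
  then have "(1 - q ^ Suc k) * (U_coeff n k - a * q ^ n * U_coeff n (Suc k))
      = (1 - q ^ Suc k) * U_coeff (Suc n) (Suc k)"
    using U_coeff_descend[of k n] by (simp add: algebra_simps)
  then show ?thesis
    using q_power_neq_1[of k] by simp
qed

text \<open>\<open>U n\<close> with every basis polynomial raised by one. The q-Pascal rule expresses it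
  by \<open>U (n + 1)\<close> and \<open>U n\<close>, and the lowering relation makes it satisfy a recursion of its own;
  eliminating it from the two gives the three-term recurrence.\<close>

definition raised_sum :: "nat \<Rightarrow> real poly" where
  "raised_sum n = (\<Sum>k\<le>n. smult (U_coeff n k) (shifted_basis (Suc k)))"

lemma U_expansion_Suc: "U n = (\<Sum>k\<le>Suc n. smult (U_coeff n k) (shifted_basis k))"
  by (simp add: U_expansion U_coeff_beyond)

lemma U_Suc_raised: "U (Suc n) = raised_sum n - smult (a * q ^ n) (U n)"
proof -
  have "U (Suc n) = smult (U_coeff (Suc n) 0) (shifted_basis 0)
      + (\<Sum>k\<le>n. smult (U_coeff (Suc n) (Suc k)) (shifted_basis (Suc k)))"
    unfolding U_expansion by (rule sum.atMost_Suc_shift)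
  also have "\<dots> = raised_sum n - smult (a * q ^ n) (smult (U_coeff n 0) (shifted_basis 0)
      + (\<Sum>k\<le>n. smult (U_coeff n (Suc k)) (shifted_basis (Suc k))))"
    by (simp add: raised_sum_def U_coeff_0 U_coeff_pascal smult_diff_left sum_subtractf
        smult_sum_right smult_add_right algebra_simps)
  also have "smult (U_coeff n 0) (shifted_basis 0)
      + (\<Sum>k\<le>n. smult (U_coeff n (Suc k)) (shifted_basis (Suc k))) = U n"
    unfolding U_expansion_Suc by (rule sum.atMost_Suc_shift[symmetric])
  finally show ?thesis .
qed

lemma shifted_basis_Suc: "shifted_basis (Suc k) = [:- (q ^ k), 1:] * shifted_basis k"
  by (simp add: shifted_basis_def)

text \<open>Splitting \<open>x - q^k = (x - 1) + (1 - q^k)\<close> lets the lowering relation absorb the dependence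
  on \<open>k\<close>.\<close>

lemma raised_sum_Suc:
  "raised_sum (Suc n) = [:-1, 1:] * U (Suc n) + smult (1 - q ^ Suc n) (raised_sum n)"
proof -
  have "raised_sum (Suc n) = (\<Sum>k\<le>Suc n. [:-1, 1:] * smult (U_coeff (Suc n) k) (shifted_basis k)
      + smult ((1 - q ^ k) * U_coeff (Suc n) k) (shifted_basis k))"
    unfolding raised_sum_def shifted_basis_Suc
    by (intro sum.cong) (auto simp: algebra_simps smult_diff_left smult_diff_right)
  also have "\<dots> = [:-1, 1:] * U (Suc n)
      + (\<Sum>k\<le>Suc n. smult ((1 - q ^ k) * U_coeff (Suc n) k) (shifted_basis k))"
    unfolding sum.distrib U_expansion sum_distrib_left ..
  also have "(\<Sum>k\<le>Suc n. smult ((1 - q ^ k) * U_coeff (Suc n) k) (shifted_basis k))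
      = (\<Sum>k\<le>n. smult ((1 - q ^ Suc k) * U_coeff (Suc n) (Suc k)) (shifted_basis (Suc k)))"
    by (subst sum.atMost_Suc_shift) simp
  also have "\<dots> = smult (1 - q ^ Suc n) (raised_sum n)"
    unfolding U_coeff_descend by (simp add: raised_sum_def smult_sum_right)
  finally show ?thesis .
qed

lemma U_0: "U 0 = 1"
  by (simp add: U_expansion U_coeff_def shifted_basis_def qpoch_def binomial_eq_0 one_pCons)

lemma U_1: "U (Suc 0) = [:- (1 + a), 1:]"
proof -
  have "raised_sum 0 = [:-1, 1:]"
    by (simp add: raised_sum_def shifted_basis_def U_coeff_def qpoch_def binomial_eq_0)
  then show ?thesis by (simp add: U_Suc_raised U_0 one_pCons)
qed

text \<open>At \<open>n = 0\<close> the last coefficient vanishes, so that the index \<open>0 - 1 = 0\<close> is harmless.\<close>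

lemma U_recurrence:
  "[:0, 1:] * U n = U (Suc n) + smult ((1 + a) * q ^ n) (U n)
     - smult (a * q ^ (n - 1) * (1 - q ^ n)) (U (n - 1))"
proof (cases n)
  case 0
  then show ?thesis by (simp add: U_0 U_1 one_pCons)
next
  case (Suc m)
  have "raised_sum m = U (Suc m) + smult (a * q ^ m) (U m)"
    by (simp add: U_Suc_raised)
  then have "U (Suc (Suc m)) = [:-1, 1:] * U (Suc m)
      + smult (1 - q ^ Suc m) (U (Suc m) + smult (a * q ^ m) (U m)) - smult (a * q ^ Suc m) (U (Suc m))"
    by (simp only: U_Suc_raised[of "Suc m"] raised_sum_Suc)
  then have "poly (U (Suc (Suc m))) x = (x - 1) * poly (U (Suc m)) x
      + (1 - q ^ Suc m) * (poly (U (Suc m)) x + a * q ^ m * poly (U m) x)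
      - a * q ^ Suc m * poly (U (Suc m)) x" for x
    by (simp add: left_diff_distrib)
  then have "poly ([:0, 1:] * U n) x = poly (U (Suc n) + smult ((1 + a) * q ^ n) (U n)
     - smult (a * q ^ (n - 1) * (1 - q ^ n)) (U (n - 1))) x" for x
    by (simp add: Suc algebra_simps)
  then show ?thesis by (simp add: poly_eq_poly_eq_iff[symmetric] fun_eq_iff)
qed

lemma U_recurrence_poly:
  "x * poly (U n) x = poly (U (Suc n)) x + (1 + a) * q ^ n * poly (U n) x
     - a * q ^ (n - 1) * (1 - q ^ n) * poly (U (n - 1)) x"
  using arg_cong[OF U_recurrence[of n], of "\<lambda>p. poly p x"] by simp

lemma coeff_U: "coeff (U n) n = 1 \<and> (\<forall>i>n. coeff (U n) i = 0)"
proof (induction n rule: less_induct)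
  case (less n)
  show ?case
  proof (cases n)
    case 0
    then show ?thesis by (simp add: U_0)
  next
    case (Suc m)
    have IH: "coeff (U m) m = 1" "\<And>i. i > m \<Longrightarrow> coeff (U m) i = 0"
        "\<And>i. i > m - 1 \<Longrightarrow> coeff (U (m - 1)) i = 0"
      using less[of m] less[of "m - 1"] Suc by auto
    have "U (Suc m) = pCons 0 (U m) - smult ((1 + a) * q ^ m) (U m)
        + smult (a * q ^ (m - 1) * (1 - q ^ m)) (U (m - 1))"
      using U_recurrence[of m] by (simp add: algebra_simps)
    then have "coeff (U n) (Suc i) = coeff (U m) i - (1 + a) * q ^ m * coeff (U m) (Suc i)
        + a * q ^ (m - 1) * (1 - q ^ m) * coeff (U (m - 1)) (Suc i)" for i
      by (simp add: Suc)
    then have "coeff (U n) n = 1" "\<And>j. j > m \<Longrightarrow> coeff (U n) (Suc j) = 0"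
      using IH Suc by simp_all
    then show ?thesis
      using Suc by (metis Suc_lessE)
  qed
qed

lemma degree_U: "degree (U n) = n"
  using coeff_U[of n] by (metis le_antisym le_degree degree_le zero_neq_one)

lemma U_monic: "degree (U n) = n \<and> coeff (U n) n = 1"
  using degree_U coeff_U by simp

lemma shifted_basis_qdiff:
  "poly (shifted_basis (Suc k)) (q * x) - poly (shifted_basis (Suc k)) x
     = (q ^ Suc k - 1) * x * poly (shifted_basis k) x"
proof (induction k)
  case 0
  then show ?case by (simp add: shifted_basis_def algebra_simps)
next
  case (Suc k)
  let ?s = "\<lambda>k x. poly (shifted_basis k) x"
  have step: "?s (Suc k) y = (y - q ^ k) * ?s k y" for k y
    by (simp add: shifted_basis_Suc algebra_simps)
  have IH: "?s (Suc k) (q * x) = ?s (Suc k) x + (q ^ Suc k - 1) * x * ?s k x"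
    using Suc by linarith
  have "?s (Suc (Suc k)) (q * x)
      = q * (x - q ^ k) * (?s (Suc k) x + (q ^ Suc k - 1) * x * ?s k x)"
    unfolding step[of "Suc k"] IH by (simp add: algebra_simps)
  also have "\<dots> = q * (x - q ^ k) * ?s (Suc k) x + q * (q ^ Suc k - 1) * x * ?s (Suc k) x"
    by (simp add: step[of k] algebra_simps)
  finally show ?case
    by (simp add: step[of "Suc k"] algebra_simps)
qed

lemma U_qdiff:
  "poly (U (Suc n)) (q * x) - poly (U (Suc n)) x = (q ^ Suc n - 1) * x * poly (U n) x"
proof -
  let ?s = "\<lambda>k x. poly (shifted_basis k) x"
  have "poly (U (Suc n)) (q * x) - poly (U (Suc n)) x
      = (\<Sum>k\<le>Suc n. U_coeff (Suc n) k * (?s k (q * x) - ?s k x))"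
    unfolding U_expansion by (simp add: poly_sum sum_subtractf right_diff_distrib)
  also have "\<dots> = (\<Sum>k\<le>n. U_coeff (Suc n) (Suc k) * (?s (Suc k) (q * x) - ?s (Suc k) x))"
    by (subst sum.atMost_Suc_shift) (simp add: shifted_basis_def)
  also have "\<dots> = (\<Sum>k\<le>n. - x * ((1 - q ^ Suc k) * U_coeff (Suc n) (Suc k)) * ?s k x)"
    unfolding shifted_basis_qdiff by (intro sum.cong) (auto simp: algebra_simps)
  also have "\<dots> = (\<Sum>k\<le>n. (q ^ Suc n - 1) * x * (U_coeff n k * ?s k x))"
    unfolding U_coeff_descend by (intro sum.cong) (auto simp: algebra_simps)
  also have "\<dots> = (q ^ Suc n - 1) * x * poly (U n) x"
    unfolding U_expansion by (simp only: poly_sum sum_distrib_left poly_smult)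
  finally show ?thesis .
qed

lemma qnum_mult: "(1 - q) * qnum q (int n) = 1 - q ^ n"
  using q_less_1 by (simp add: qnum_def)

lemma qderiv_U:
  "qderiv q (poly (U n)) x = qnum q (int n) * poly (U (n - 1)) x"
proof (cases n)
  case 0
  then show ?thesis by (simp add: U_0 qnum_def qderiv_poly)
next
  case (Suc m)
  have "qderiv q (poly (U (Suc m))) x = poly (smult (qnum q (int (Suc m))) (U m)) x"
  proof (rule qderiv_poly_eqI)
    show "poly (U (Suc m)) (q * y) - poly (U (Suc m)) y
        = (q - 1) * y * poly (smult (qnum q (int (Suc m))) (U m)) y" for y
    proof -
      have "(q - 1) * y * (qnum q (int (Suc m)) * u) = - ((1 - q) * qnum q (int (Suc m))) * y * u" for u
        by (simp add: algebra_simps)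
      then show ?thesis
        unfolding U_qdiff qnum_mult poly_smult by (metis minus_diff_eq)
    qed
  qed (use q_less_1 in simp)
  then show ?thesis by (simp add: Suc)
qed

section \<open>The orthogonality functional\<close>

definition weight :: "real \<Rightarrow> real" where
  "weight x = qpoch_inf (q * x) q * qpoch_inf (q * x / a) q"

text \<open>The functional \<open>u\<close> of the orthogonality relation. It is restricted to polynomials because its
  additivity rests on the convergence of the Jackson sums.\<close>

definition L :: "real poly \<Rightarrow> real" where
  "L p = asc_functional q a (poly p)"

lemma node_params:
  assumes "c = 1 \<or> c = a"
  shows "q * c < 1" "q * c / a < 1"
proof -
  have "q * a < 0" "q / a < 0"
    using q_pos a_neg by (auto simp: mult_less_0_iff divide_less_0_iff)
  then show "q * c < 1" "q * c / a < 1"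
    using assms q_less_1 by auto
qed

lemma weight_pos:
  assumes "c = 1 \<or> c = a"
  shows "0 < weight (c * q ^ k)"
proof -
  have "b * q ^ k < 1" if "b < 1" for b
    using one_minus_mult_power_pos[OF q_pos q_less_1 that, of k] by simp
  from this[OF node_params(1)[OF assms]] this[OF node_params(2)[OF assms]]
  have "q * (c * q ^ k) < 1" "q * (c * q ^ k) / a < 1"
    by (simp_all add: mult_ac)
  then show ?thesis
    unfolding weight_def by (intro mult_pos_pos qpoch_inf_pos q_pos q_less_1)
qed

lemma weight_tendsto_1:
  assumes "c = 1 \<or> c = a"
  shows "(\<lambda>k. weight (c * q ^ k)) \<longlonglongrightarrow> 1"
proof -
  have "(\<lambda>k. qpoch_inf (q * c * q ^ k) q * qpoch_inf (q * c / a * q ^ k) q) \<longlonglongrightarrow> 1 * 1"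
    using node_params[OF assms] by (intro tendsto_mult qpoch_inf_tail_tendsto_1 q_pos q_less_1)
  then show ?thesis
    by (simp add: weight_def mult_ac)
qed

lemma poly_node_tendsto: "(\<lambda>k. poly p (c * q ^ k)) \<longlonglongrightarrow> poly p 0"
proof -
  have "(\<lambda>k. c * q ^ k) \<longlonglongrightarrow> c * 0"
    using q_pos q_less_1 by (intro tendsto_intros LIMSEQ_power_zero) auto
  then show ?thesis
    by (intro tendsto_poly) simp
qed

definition jackson_sum :: "real \<Rightarrow> real poly \<Rightarrow> real" where
  "jackson_sum c p = (\<Sum>k. poly p (c * q ^ k) * weight (c * q ^ k) * q ^ k)"

lemma L_eq: "L p = (1 - q) * jackson_sum 1 p - a * (1 - q) * jackson_sum a p"
proof -
  have "qpochs_inf [q * x, q * x / a] q = weight x" for x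
    by (simp add: qpochs_inf_def weight_def)
  then show ?thesis
    unfolding L_def asc_functional_def qintegral_def jackson_sum_def by (simp only: mult_1_left)
qed

text \<open>The weight and the polynomial converge along the nodes, so the geometric factor
  dominates.\<close>

lemma summable_jackson_sum:
  assumes "c = 1 \<or> c = a"
  shows "summable (\<lambda>k. poly p (c * q ^ k) * weight (c * q ^ k) * q ^ k)"
proof -
  have "convergent (\<lambda>k. poly p (c * q ^ k) * weight (c * q ^ k))"
    by (rule convergentI[OF tendsto_mult[OF poly_node_tendsto weight_tendsto_1[OF assms]]])
  then have "Bseq (\<lambda>k. poly p (c * q ^ k) * weight (c * q ^ k))"
    by (rule convergent_imp_Bseq)
  then obtain B where "\<forall>k. norm (poly p (c * q ^ k) * weight (c * q ^ k)) \<le> B"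
    by (rule BseqE)
  then have "norm (poly p (c * q ^ k) * weight (c * q ^ k)) * norm (q ^ k) \<le> B * norm (q ^ k)" for k
    by (intro mult_right_mono) auto
  then have bound: "norm (poly p (c * q ^ k) * weight (c * q ^ k) * q ^ k) \<le> B * q ^ k" for k
    unfolding norm_mult[of _ "q ^ k"] using q_pos by simp
  have "summable (\<lambda>k. B * q ^ k)"
    using q_pos q_less_1 by (intro summable_mult summable_geometric) auto
  then show ?thesis
    by (rule summable_comparison_test') (rule bound)
qed

lemma jackson_sum_add:
  assumes "c = 1 \<or> c = a"
  shows "jackson_sum c (p + r) = jackson_sum c p + jackson_sum c r"
  using suminf_add[OF summable_jackson_sum[OF assms, of p] summable_jackson_sum[OF assms, of r]]
  by (simp add: jackson_sum_def distrib_right)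

lemma jackson_sum_smult:
  assumes "c = 1 \<or> c = a"
  shows "jackson_sum c (smult s p) = s * jackson_sum c p"
  using suminf_mult[OF summable_jackson_sum[OF assms, of p], of s]
  by (simp add: jackson_sum_def mult.assoc)

lemma L_add: "L (p + r) = L p + L r"
  by (simp add: L_eq jackson_sum_add algebra_simps)

lemma L_smult: "L (smult c p) = c * L p"
  by (simp add: L_eq jackson_sum_smult algebra_simps)

lemma L_diff: "L (p - r) = L p - L r"
proof -
  have "p - r = p + smult (-1) r" by simp
  then show ?thesis by (simp only: L_add L_smult)
qed

lemma L_sum: "L (\<Sum>i\<in>I. p i) = (\<Sum>i\<in>I. L (p i))"
proof -
  have "L 0 = 0"
    using L_smult[of 0 0] by simp
  then show ?thesis
    by (induction I rule: infinite_finite_induct) (simp_all add: L_add)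
qed

text \<open>The weight is positive at all nodes (here \<open>a < 0\<close> is used), and a polynomial cannot vanish at
  infinitely many nodes \<open>q^k\<close>.\<close>

lemma L_square_pos:
  assumes "p \<noteq> 0"
  shows "0 < L (p * p)"
proof -
  have nonneg: "0 \<le> poly (p * p) (c * q ^ k) * weight (c * q ^ k) * q ^ k" if "c = 1 \<or> c = a" for c k
    using weight_pos[OF that, of k] q_pos by simp
  have "\<exists>k. poly p (q ^ k) \<noteq> 0"
  proof (rule ccontr)
    assume "\<not> ?thesis"
    then have "range (\<lambda>k. q ^ k) \<subseteq> {x. poly p x = 0}" by auto
    then have "finite (range (\<lambda>k. q ^ k))"
      using poly_roots_finite[OF assms] finite_subset by blast
    moreover have "inj (\<lambda>k. q ^ k)"
    proof (rule linorder_injI)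
      show "q ^ i \<noteq> q ^ j" if "i < j" for i j :: nat
        using power_strict_decreasing[OF that q_pos q_less_1] by simp
    qed
    ultimately show False
      using finite_imageD by blast
  qed
  then obtain k where "poly p (q ^ k) \<noteq> 0" by blast
  then have "0 < poly (p * p) (q ^ k)"
    by (auto simp: zero_less_mult_iff)
  then have "0 < poly (p * p) (1 * q ^ k) * weight (1 * q ^ k) * q ^ k"
    using weight_pos[of 1 k] q_pos by simp
  then have "0 < jackson_sum 1 (p * p)"
    unfolding jackson_sum_def using nonneg[of 1]
    by (intro suminf_pos2[of _ k] summable_jackson_sum) auto
  moreover have "0 \<le> jackson_sum a (p * p)"
    unfolding jackson_sum_def using nonneg[of a]
    by (intro suminf_nonneg summable_jackson_sum) auto
  ultimately have "0 < (1 - q) * jackson_sum 1 (p * p)" "a * (1 - q) * jackson_sum a (p * p) \<le> 0"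
    using q_less_1 a_neg by (simp_all add: mult_nonpos_nonneg)
  then show ?thesis
    unfolding L_eq by linarith
qed

text \<open>The infinite product at \<open>x\<close> and the weight, which is the same product at \<open>q x\<close>, differ by a
  quadratic factor vanishing at the endpoints \<open>1\<close> and \<open>a\<close> of the Jackson integral.\<close>

lemma weight_pearson:
  "qpoch_inf x q * qpoch_inf (x / a) q = (1 - x) * (1 - x / a) * weight x"
proof -
  have "x / a * q = q * x / a" by simp
  then have "qpoch_inf (x / a) q = (1 - x / a) * qpoch_inf (q * x / a) q"
    using qpoch_inf_head[OF q_pos q_less_1, of "x / a"] by metis
  moreover have "qpoch_inf x q = (1 - x) * qpoch_inf (q * x) q"
    using qpoch_inf_head[OF q_pos q_less_1, of x] by (metis mult.commute)
  ultimately show ?thesis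
    unfolding weight_def by (simp only: mult_ac)
qed

text \<open>With \<open>G x = (x, x/a; q)_\<infinity> p x\<close>, the summand times \<open>c\<close> is \<open>a (G (c q^k) - G (c q^(k+1)))\<close>.
  The sum telescopes; \<open>G\<close> vanishes at the endpoint \<open>c\<close> and tends to \<open>p 0\<close> along the nodes.\<close>

lemma pearson_telescope:
  assumes c: "c = 1 \<or> c = a"
    and diff: "\<And>x. poly p (q * x) - poly p x = (q - 1) * x * poly d x"
  shows "c * jackson_sum c ([:- (1 + a), 1:] * p + smult (a * (1 - q)) d) = - a * poly p 0"
proof -
  let ?g = "[:- (1 + a), 1:] * p + smult (a * (1 - q)) d"
  define G where "G x = qpoch_inf x q * qpoch_inf (x / a) q * poly p x" for x
  have G_shift: "G (q * x) = weight x * poly p (q * x)" for x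
    unfolding G_def weight_def ..
  have step: "x * (poly ?g x * weight x) = a * (G x - G (q * x))" for x
  proof -
    have "a * (G x - G (q * x)) = weight x * (a * ((1 - x) * (1 - x / a) * poly p x) - a * poly p (q * x))"
      unfolding G_shift unfolding G_def weight_pearson by (simp add: right_diff_distrib mult_ac)
    also have "poly p (q * x) = poly p x + (q - 1) * x * poly d x"
      using diff[of x] by simp
    also have "a * ((1 - x) * (1 - x / a) * poly p x) = (1 - x) * (a - x) * poly p x"
      using a_neg by (simp add: field_simps)
    finally show ?thesis by (simp add: algebra_simps)
  qed
  have "c * (poly ?g (c * q ^ k) * weight (c * q ^ k) * q ^ k)
      = a * (G (c * q ^ k) - G (c * q ^ Suc k))" for k
    using step[of "c * q ^ k"] by (simp add: mult_ac)
  moreover have "(\<lambda>k. G (c * q ^ k)) \<longlonglongrightarrow> poly p 0"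
  proof (rule LIMSEQ_imp_Suc)
    have "(\<lambda>k. weight (c * q ^ k) * poly p (c * q * q ^ k)) \<longlonglongrightarrow> 1 * poly p 0"
      by (intro tendsto_mult weight_tendsto_1 c poly_node_tendsto)
    moreover have "weight (c * q ^ k) * poly p (c * q * q ^ k) = G (c * q ^ Suc k)" for k
      using G_shift[of "c * q ^ k"] by (simp add: mult_ac)
    ultimately show "(\<lambda>k. G (c * q ^ Suc k)) \<longlonglongrightarrow> poly p 0" by simp
  qed
  then have "(\<lambda>k. a * (G (c * q ^ k) - G (c * q ^ Suc k))) sums (a * (G (c * q ^ 0) - poly p 0))"
    by (intro sums_mult telescope_sums')
  moreover have "G (c * q ^ 0) = 0"
    using c a_neg unfolding G_def weight_pearson by auto
  ultimately have "(\<lambda>k. c * (poly ?g (c * q ^ k) * weight (c * q ^ k) * q ^ k)) sums (- a * poly p 0)"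
    by simp
  then show ?thesis
    using suminf_mult[OF summable_jackson_sum[OF c, of ?g], of c]
    by (simp add: sums_iff jackson_sum_def del: poly_add poly_mult)
qed

text \<open>The Pearson equation of the functional: the two Jackson sums leave the same limit at \<open>0\<close>, and
  these cancel. The polynomial \<open>d\<close> is the q-derivative of \<open>p\<close>.\<close>

lemma L_pearson:
  assumes "\<And>x. poly p (q * x) - poly p x = (q - 1) * x * poly d x"
  shows "L ([:- (1 + a), 1:] * p) = - a * (1 - q) * L d"
proof -
  let ?g = "[:- (1 + a), 1:] * p + smult (a * (1 - q)) d"
  have "L ?g = (1 - q) * (1 * jackson_sum 1 ?g) - (1 - q) * (a * jackson_sum a ?g)"
    unfolding L_eq by simp
  also have "\<dots> = 0"
    using pearson_telescope[OF _ assms, of 1] pearson_telescope[OF _ assms, of a] by simp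
  finally have "L ?g = 0" .
  then show ?thesis by (simp only: L_add L_smult)
qed

lemma L_U_recurrence:
  "L ([:0, 1:] * p * U n) = L (p * U (Suc n)) + (1 + a) * q ^ n * L (p * U n)
     - a * q ^ (n - 1) * (1 - q ^ n) * L (p * U (n - 1))"
proof -
  have "[:0, 1:] * p * U n = p * ([:0, 1:] * U n)" by simp
  also have "\<dots> = p * U (Suc n) + smult ((1 + a) * q ^ n) (p * U n)
     - smult (a * q ^ (n - 1) * (1 - q ^ n)) (p * U (n - 1))"
    unfolding U_recurrence by (simp add: algebra_simps)
  finally show ?thesis by (simp only: L_add L_diff L_smult)
qed

text \<open>The Pearson equation for \<open>U (n + 1)\<close>, whose q-derivative is a multiple of \<open>U n\<close>, and the
  three-term recurrence both evaluate \<open>L\<close> on \<open>x U (n + 1)\<close>. Comparing them gives a homogeneous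
  recursion for \<open>L (U n)\<close> in which the coefficient of \<open>L (U 0)\<close> is zero; it starts from
  \<open>L (U 1) = 0\<close>, the Pearson equation for the constant \<open>1\<close>.\<close>

lemma L_U_Suc: "L (U (Suc n)) = 0"
proof -
  have rec: "L (U (Suc (Suc m))) = (1 + a) * (1 - q ^ Suc m) * L (U (Suc m))
      - a * (1 - q ^ m) * (1 - q ^ Suc m) * L (U m)" for m
  proof -
    have "L ([:- (1 + a), 1:] * U (Suc m)) = - a * (1 - q) * L (smult ((1 - q ^ Suc m) / (1 - q)) (U m))"
      using q_less_1 by (intro L_pearson) (simp add: U_qdiff divide_simps, simp add: algebra_simps)
    then have "L ([:- (1 + a), 1:] * U (Suc m)) = - a * (1 - q ^ Suc m) * L (U m)"
      using q_less_1 by (simp add: L_smult)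
    moreover have "[:- (1 + a), 1:] * U (Suc m) = [:0, 1:] * 1 * U (Suc m) - smult (1 + a) (U (Suc m))"
      by (simp flip: smult_minus_left)
    ultimately have "L ([:0, 1:] * 1 * U (Suc m)) = (1 + a) * L (U (Suc m)) - a * (1 - q ^ Suc m) * L (U m)"
      by (simp only: L_diff L_smult)
    then show ?thesis
      unfolding L_U_recurrence by (simp add: algebra_simps)
  qed
  show ?thesis
  proof (induction n rule: less_induct)
    case (less n)
    show ?case
    proof (cases n)
      case 0
      have "L ([:- (1 + a), 1:] * U 0) = - a * (1 - q) * L 0"
        by (intro L_pearson) (simp add: U_0)
      then show ?thesis
        using L_smult[of 0 0] 0 by (simp add: U_0 U_1)
    next
      case (Suc m)
      have "(1 - q ^ m) * L (U m) = 0"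
        using less[of "m - 1"] Suc by (cases m) auto
      then show ?thesis
        using rec[of m] less[of m] Suc by auto
    qed
  qed
qed

section \<open>Orthogonality and the Christoffel--Darboux formula\<close>

text \<open>Multiplication by \<open>x\<close> moves the index of \<open>U\<close> by at most one, so \<open>x^m U n\<close> only involves
  \<open>U j\<close> with \<open>j \<ge> n - m > 0\<close>, where \<open>L\<close> vanishes.\<close>

lemma L_monom_U: "m < n \<Longrightarrow> L (monom 1 m * U n) = 0"
proof (induction m arbitrary: n)
  case 0
  then show ?case
    using L_U_Suc[of "n - 1"] by (simp add: monom_0)
next
  case (Suc m)
  have "monom 1 (Suc m) = [:0, 1:] * (monom 1 m :: real poly)"
    by (simp add: monom_Suc)
  then show ?case
    using Suc.IH[of "Suc n"] Suc.IH[of n] Suc.IH[of "n - 1"] Suc.prems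
    by (simp del: mult_pCons_left add: L_U_recurrence)
qed

lemma U_orthogonal_low_degree:
  assumes "\<And>i. i \<ge> n \<Longrightarrow> coeff p i = 0"
  shows "L (p * U n) = 0"
proof (rule linear_vanishes_below_degree[of "monom 1" "\<lambda>p. L (p * U n)" n p])
  show "degree (monom (1::real) k) = k \<and> coeff (monom (1::real) k) k = 1" for k
    by (simp add: degree_monom_eq)
qed (use assms in \<open>simp_all add: distrib_right L_add L_smult L_monom_U\<close>)

lemma U_orthogonal:
  assumes "m \<noteq> n"
  shows "L (U m * U n) = 0"
proof (cases "m < n")
  case True
  then show ?thesis using coeff_U[of m] by (intro U_orthogonal_low_degree) auto
next
  case False
  then have "L (U n * U m) = 0"
    using assms coeff_U[of n] by (intro U_orthogonal_low_degree) auto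
  then show ?thesis by (simp add: mult.commute)
qed

definition U_norm2 :: "nat \<Rightarrow> real" where
  "U_norm2 n = L (U n * U n)"

lemma asc_norm2_eq: "asc_norm2 q a (int n) = U_norm2 n"
proof -
  have "poly (U n * U n) = (\<lambda>x. (poly (U n) x)\<^sup>2)"
    by (auto simp: power2_eq_square)
  then show ?thesis by (simp add: asc_norm2_def U_norm2_def L_def U_def)
qed

lemma U_norm2_pos: "0 < U_norm2 n"
  unfolding U_norm2_def using U_monic[of n] by (intro L_square_pos) auto

text \<open>Both sides are \<open>L (x U n U (n + 1))\<close>, with \<open>x\<close> absorbed into one factor or the other.\<close>

lemma U_norm2_Suc: "U_norm2 (Suc n) = - a * q ^ n * (1 - q ^ Suc n) * U_norm2 n"
proof -
  have "L ([:0, 1:] * U (Suc n) * U n) = U_norm2 (Suc n)"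
    using U_orthogonal[of "Suc n" n] U_orthogonal[of "Suc n" "n - 1"]
    by (simp del: mult_pCons_left add: L_U_recurrence U_norm2_def)
  moreover have "L ([:0, 1:] * U n * U (Suc n)) = - a * q ^ n * (1 - q ^ Suc n) * U_norm2 n"
    using U_orthogonal[of n "Suc n"] U_orthogonal[of n "Suc (Suc n)"]
    by (simp del: mult_pCons_left add: L_U_recurrence U_norm2_def)
  ultimately show ?thesis by (simp only: mult_ac)
qed

text \<open>By induction: the step is the three-term recurrence, whose last coefficient is the ratio of
  consecutive squared norms by \<open>U_norm2_Suc\<close>.\<close>

lemma christoffel_darboux:
  "U_norm2 n * ((x - y) * (\<Sum>k<Suc n. poly (U k) x / U_norm2 k * poly (U k) y))
    = poly (U (Suc n)) x * poly (U n) y - poly (U n) x * poly (U (Suc n)) y"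
proof (induction n)
  case 0
  then show ?case using U_norm2_pos[of 0] by (simp add: U_0 U_1)
next
  case (Suc n)
  define S where "S = (\<Sum>k<Suc n. poly (U k) x / U_norm2 k * poly (U k) y)"
  let ?u = "\<lambda>n. poly (U n)"
  have "U_norm2 (Suc n) * ((x - y) * (S + ?u (Suc n) x / U_norm2 (Suc n) * ?u (Suc n) y))
      = U_norm2 (Suc n) * ((x - y) * S) + (x - y) * (?u (Suc n) x * ?u (Suc n) y)"
    using U_norm2_pos[of "Suc n"] by (simp add: field_simps)
  also have "U_norm2 (Suc n) * ((x - y) * S) = - a * q ^ n * (1 - q ^ Suc n) * (U_norm2 n * ((x - y) * S))"
    by (simp add: U_norm2_Suc)
  also have "U_norm2 n * ((x - y) * S) = ?u (Suc n) x * ?u n y - ?u n x * ?u (Suc n) y"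
    using Suc by (simp add: S_def)
  also have "(x - y) * (?u (Suc n) x * ?u (Suc n) y)
      = (x * ?u (Suc n) x) * ?u (Suc n) y - (y * ?u (Suc n) y) * ?u (Suc n) x"
    by (simp add: algebra_simps)
  finally show ?case
    unfolding U_recurrence_poly S_def by (simp add: algebra_simps)
qed

section \<open>The Sobolev-type polynomials\<close>

definition dU :: "real \<Rightarrow> nat \<Rightarrow> real" where
  "dU \<alpha> k = qderiv q (poly (U k)) \<alpha>"

text \<open>The reproducing kernel of the polynomials of degree below \<open>n\<close>, q-differentiated in its second
  argument at \<open>\<alpha>\<close>: by \<open>L_kernel01\<close> it represents the functional \<open>p \<mapsto> (D p) \<alpha>\<close>.\<close>

definition kernel01 :: "real \<Rightarrow> nat \<Rightarrow> real poly" where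
  "kernel01 \<alpha> n = (\<Sum>k<n. smult (dU \<alpha> k / U_norm2 k) (U k))"

definition sobolev_poly :: "real \<Rightarrow> real \<Rightarrow> nat \<Rightarrow> real poly" where
  "sobolev_poly \<alpha> N n =
     U n - smult (N * dU \<alpha> n / (1 + N * asc_kernel11 q a n \<alpha>)) (kernel01 \<alpha> n)"

lemma asc_kernel11_eq: "asc_kernel11 q a n \<alpha> = (\<Sum>k<n. (dU \<alpha> k)\<^sup>2 / U_norm2 k)"
  by (simp add: asc_kernel11_def asc_norm2_eq dU_def U_def[symmetric])

lemma asc_kernel11_nonneg: "0 \<le> asc_kernel11 q a n \<alpha>"
  unfolding asc_kernel11_eq using U_norm2_pos by (intro sum_nonneg) (simp add: less_imp_le)

lemma coeff_kernel01: "i \<ge> n \<Longrightarrow> coeff (kernel01 \<alpha> n) i = 0"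
  using coeff_U by (simp add: kernel01_def coeff_sum)

lemma qderiv_kernel01: "qderiv q (poly (kernel01 \<alpha> n)) \<alpha> = asc_kernel11 q a n \<alpha>"
  unfolding kernel01_def asc_kernel11_eq
  by (simp add: qderiv_poly_sum qderiv_poly_smult power2_eq_square flip: dU_def)

lemma L_kernel01:
  assumes "k < n"
  shows "L (kernel01 \<alpha> n * U k) = dU \<alpha> k"
proof -
  have "L (kernel01 \<alpha> n * U k) = (\<Sum>j<n. dU \<alpha> j / U_norm2 j * L (U j * U k))"
    by (simp add: kernel01_def sum_distrib_right L_sum L_smult)
  also have "\<dots> = (\<Sum>j<n. if j = k then dU \<alpha> k else 0)"
    using U_norm2_pos[of k] by (intro sum.cong) (auto simp: U_orthogonal U_norm2_def[symmetric])
  finally show ?thesis using assms by simp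
qed

lemma sobolev_inner_poly:
  "sobolev_inner q a \<alpha> N (poly p) (poly r)
    = L (p * r) + N * qderiv q (poly p) \<alpha> * qderiv q (poly r) \<alpha>"
proof -
  have "poly (p * r) = (\<lambda>x. poly p x * poly r x)" by auto
  then show ?thesis by (simp add: sobolev_inner_def L_def)
qed

lemma sobolev_inner_add:
  "sobolev_inner q a \<alpha> N (poly (p + r)) (poly s)
    = sobolev_inner q a \<alpha> N (poly p) (poly s) + sobolev_inner q a \<alpha> N (poly r) (poly s)"
  unfolding sobolev_inner_poly qderiv_poly_add by (simp add: distrib_right L_add algebra_simps)

lemma sobolev_inner_smult:
  "sobolev_inner q a \<alpha> N (poly (smult c p)) (poly s) = c * sobolev_inner q a \<alpha> N (poly p) (poly s)"
  unfolding sobolev_inner_poly qderiv_poly_smult by (simp add: L_smult algebra_simps)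

lemma sobolev_inner_commute:
  "sobolev_inner q a \<alpha> N (poly p) (poly r) = sobolev_inner q a \<alpha> N (poly r) (poly p)"
  unfolding sobolev_inner_poly by (simp add: mult_ac)

text \<open>The coefficient \<open>c\<close> of the kernel is the solution of \<open>c = N (D S) \<alpha>\<close> for
  \<open>S = U n - c kernel01\<close>: the kernel contributes \<open>- c (D p) \<alpha>\<close> to the continuous part of the inner
  product with \<open>p\<close>, which then cancels the discrete part. Its denominator is positive because
  \<open>asc_kernel11\<close> is a sum of squares over positive norms.\<close>

lemma sobolev_poly_orthogonal_U:
  assumes "0 \<le> N" "k < n"
  shows "sobolev_inner q a \<alpha> N (poly (U k)) (poly (sobolev_poly \<alpha> N n)) = 0"
proof -
  define \<kappa> where "\<kappa> = asc_kernel11 q a n \<alpha>"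
  define c where "c = N * dU \<alpha> n / (1 + N * \<kappa>)"
  have S: "sobolev_poly \<alpha> N n = U n - smult c (kernel01 \<alpha> n)"
    by (simp add: sobolev_poly_def c_def \<kappa>_def)
  have "1 + N * \<kappa> > 0"
    using assms asc_kernel11_nonneg[of n \<alpha>] by (simp add: \<kappa>_def add_pos_nonneg)
  then have c: "N * (dU \<alpha> n - c * \<kappa>) = c"
    unfolding c_def by (simp add: field_simps)
  have "L (U k * sobolev_poly \<alpha> N n) = - c * dU \<alpha> k"
    using assms U_orthogonal[of k n] L_kernel01[of k n \<alpha>]
    by (simp add: S right_diff_distrib L_diff L_smult mult.commute[of _ "kernel01 \<alpha> n"])
  moreover have "qderiv q (poly (sobolev_poly \<alpha> N n)) \<alpha> = dU \<alpha> n - c * \<kappa>"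
    unfolding S qderiv_poly_diff qderiv_poly_smult qderiv_kernel01 by (simp add: dU_def \<kappa>_def)
  ultimately have "sobolev_inner q a \<alpha> N (poly (U k)) (poly (sobolev_poly \<alpha> N n))
      = - c * dU \<alpha> k + dU \<alpha> k * (N * (dU \<alpha> n - c * \<kappa>))"
    unfolding sobolev_inner_poly by (simp add: dU_def)
  then show ?thesis
    unfolding c by simp
qed

lemma coeff_sobolev_poly: "coeff (sobolev_poly \<alpha> N n) n = 1"
    "i > n \<Longrightarrow> coeff (sobolev_poly \<alpha> N n) i = 0"
  using coeff_U[of n] by (auto simp: sobolev_poly_def coeff_kernel01)

lemma sobolev_poly_monic_orthogonal:
  assumes "0 \<le> N"
  shows "monic_orthogonal (sobolev_inner q a \<alpha> N) (sobolev_poly \<alpha> N)"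
proof -
  let ?ip = "\<lambda>p r. sobolev_inner q a \<alpha> N (poly p) (poly r)" and ?S = "sobolev_poly \<alpha> N"
  have "degree (?S n) = n" for n
    using coeff_sobolev_poly by (intro le_antisym degree_le le_degree) auto
  moreover have "?ip (?S m) (?S n) = 0" if "m < n" for m n
    using that assms coeff_sobolev_poly(2)
    by (intro linear_vanishes_below_degree[of U "\<lambda>p. ?ip p (?S n)" n "?S m"] U_monic
        sobolev_inner_add sobolev_inner_smult sobolev_poly_orthogonal_U) auto
  ultimately show ?thesis
    unfolding monic_orthogonal_def
    by (auto simp: coeff_sobolev_poly neq_iff) (metis sobolev_inner_commute)
qed

lemma asc_sobolev_eq:
  assumes "0 \<le> N"
  shows "asc_sobolev q a \<alpha> N = sobolev_poly \<alpha> N"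
  unfolding asc_sobolev_def
proof (rule the_equality)
  fix P
  have "0 < sobolev_inner q a \<alpha> N (poly p) (poly p)" if "p \<noteq> 0" for p
  proof -
    have "0 \<le> N * qderiv q (poly p) \<alpha> * qderiv q (poly p) \<alpha>"
      using assms by (simp add: mult.assoc)
    then show ?thesis
      using L_square_pos[OF that] unfolding sobolev_inner_poly by linarith
  qed
  then show "monic_orthogonal (sobolev_inner q a \<alpha> N) P \<Longrightarrow> P = sobolev_poly \<alpha> N"
    using sobolev_poly_monic_orthogonal[OF assms]
    by (intro monic_orthogonal_unique[of "sobolev_inner q a \<alpha> N"]
        sobolev_inner_add sobolev_inner_smult sobolev_inner_commute)
qed (rule sobolev_poly_monic_orthogonal[OF assms])

text \<open>The q-derivative of the Christoffel--Darboux formula in its second variable, at \<open>\<alpha>\<close>. The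
  q-Leibniz rule for the factor \<open>x - y\<close> produces the two poles \<open>\<alpha>\<close> and \<open>q \<alpha>\<close> of the connection
  coefficients.\<close>

lemma kernel01_closed_form:
  "U_norm2 n * ((x - q * \<alpha>) * ((x - \<alpha>) * poly (kernel01 \<alpha> (Suc n)) x))
    = poly (U (Suc n)) x * (poly (U n) \<alpha> + (x - \<alpha>) * dU \<alpha> n)
      - poly (U n) x * (poly (U (Suc n)) \<alpha> + (x - \<alpha>) * dU \<alpha> (Suc n))"
proof -
  define K where "K = (\<Sum>k<Suc n. smult (poly (U k) x / U_norm2 k) (U k))"
  have "smult (U_norm2 n) ([:x, -1:] * K)
      = smult (poly (U (Suc n)) x) (U n) - smult (poly (U n) x) (U (Suc n))"
    (is "?l = ?r")
  proof -
    have "poly ?l y = poly ?r y" for y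
    proof -
      have "poly K y = (\<Sum>k<Suc n. poly (U k) x / U_norm2 k * poly (U k) y)"
        by (simp only: K_def poly_sum poly_smult)
      moreover have "poly ?l y = U_norm2 n * ((x - y) * poly K y)"
        by (simp add: left_diff_distrib)
      ultimately show ?thesis
        using christoffel_darboux[of n x y] by (simp only: poly_diff poly_smult)
    qed
    then show ?thesis by (simp add: poly_eq_poly_eq_iff[symmetric] fun_eq_iff)
  qed
  from arg_cong[OF this, of "\<lambda>p. qderiv q (poly p) \<alpha>"]
  have diff: "U_norm2 n * ((x - q * \<alpha>) * qderiv q (poly K) \<alpha> - poly K \<alpha>)
      = poly (U (Suc n)) x * dU \<alpha> n - poly (U n) x * dU \<alpha> (Suc n)"
    unfolding qderiv_poly_smult qderiv_poly_diff
    using q_less_1 by (subst (asm) qderiv_poly_linear_mult) (auto simp: dU_def)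
  have qderiv_K: "qderiv q (poly K) \<alpha> = poly (kernel01 \<alpha> (Suc n)) x"
    unfolding K_def kernel01_def qderiv_poly_sum qderiv_poly_smult poly_sum poly_smult dU_def
    by (intro sum.cong) (auto simp: mult_ac)
  have at_\<alpha>: "U_norm2 n * ((x - \<alpha>) * poly K \<alpha>)
      = poly (U (Suc n)) x * poly (U n) \<alpha> - poly (U n) x * poly (U (Suc n)) \<alpha>"
    unfolding K_def poly_sum poly_smult by (rule christoffel_darboux)
  have "U_norm2 n * ((x - q * \<alpha>) * ((x - \<alpha>) * poly (kernel01 \<alpha> (Suc n)) x))
      = (x - \<alpha>) * (U_norm2 n * ((x - q * \<alpha>) * qderiv q (poly K) \<alpha> - poly K \<alpha>))
        + U_norm2 n * ((x - \<alpha>) * poly K \<alpha>)"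
    unfolding qderiv_K by (simp add: algebra_simps)
  also have "\<dots> = poly (U (Suc n)) x * (poly (U n) \<alpha> + (x - \<alpha>) * dU \<alpha> n)
      - poly (U n) x * (poly (U (Suc n)) \<alpha> + (x - \<alpha>) * dU \<alpha> (Suc n))"
    unfolding diff at_\<alpha> by (simp add: algebra_simps)
  finally show ?thesis .
qed

lemma dU_eq: "dU \<alpha> n = qnum q (int n) * poly (asc q a (int n - 1)) \<alpha>"
proof (cases n)
  case 0
  then show ?thesis unfolding dU_def qderiv_U by (simp add: qnum_def)
next
  case (Suc m)
  then show ?thesis unfolding dU_def qderiv_U by (simp add: U_def)
qed

lemma sobolev_connection:
  assumes "x \<noteq> \<alpha>" "x \<noteq> \<alpha> * q"
  shows "poly (sobolev_poly \<alpha> N (Suc n)) x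
    = sob_A q a \<alpha> N (Suc n) x * poly (U (Suc n)) x + sob_B q a \<alpha> N (Suc n) x * poly (U n) x"
proof -
  define \<kappa> where "\<kappa> = 1 + N * asc_kernel11 q a (Suc n) \<alpha>"
  define d where "d = U_norm2 n * (x - \<alpha>) * (x - \<alpha> * q)"
  define E where "E = poly (U n) \<alpha> + (x - \<alpha>) * dU \<alpha> n"
  define F where "F = poly (U (Suc n)) \<alpha> + (x - \<alpha>) * dU \<alpha> (Suc n)"
  have d: "d \<noteq> 0"
    using assms U_norm2_pos[of n] by (simp add: d_def)
  have dU_Suc: "dU \<alpha> (Suc n) = qnum q (int (Suc n)) * poly (U n) \<alpha>"
    by (simp add: dU_eq U_def)
  have A: "sob_A q a \<alpha> N (Suc n) x = 1 - N * dU \<alpha> (Suc n) * E / (d * \<kappa>)"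
    unfolding sob_A_def Let_def E_def dU_Suc dU_eq[of \<alpha> n] d_def \<kappa>_def
    by (simp add: U_def asc_norm2_eq mult_ac)
  have B: "sob_B q a \<alpha> N (Suc n) x = N * dU \<alpha> (Suc n) * F / (d * \<kappa>)"
    unfolding sob_B_def Let_def F_def dU_Suc d_def \<kappa>_def
    by (simp add: U_def asc_norm2_eq mult_ac)
  have "d * poly (kernel01 \<alpha> (Suc n)) x = poly (U (Suc n)) x * E - poly (U n) x * F"
    using kernel01_closed_form[of n x \<alpha>] by (simp add: d_def E_def F_def mult_ac)
  then have K: "poly (kernel01 \<alpha> (Suc n)) x = (poly (U (Suc n)) x * E - poly (U n) x * F) / d"
    using d by (simp add: field_simps)
  have "poly (sobolev_poly \<alpha> N (Suc n)) x
      = poly (U (Suc n)) x - N * dU \<alpha> (Suc n) / \<kappa> * poly (kernel01 \<alpha> (Suc n)) x"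
    by (simp add: sobolev_poly_def \<kappa>_def)
  then show ?thesis
    unfolding A B K by (simp add: diff_divide_distrib algebra_simps)
qed

section \<open>The hypergeometric representation\<close>

text \<open>Eliminating \<open>U_coeff n (k - 1)\<close> from the q-Pascal rule and the lowering relation expresses the
  coefficients of \<open>U n\<close> by those of \<open>U (n + 1)\<close> at the same \<open>k\<close>, so that a combination of the
  two polynomials is a single sum.\<close>

lemma U_coeff_ascend:
  "(1 - q ^ Suc n) * (a * q ^ n * U_coeff n k) = (q ^ Suc n - q ^ k) * U_coeff (Suc n) k"
proof (cases k)
  case 0
  then show ?thesis by (simp add: U_coeff_0 algebra_simps)
next
  case (Suc j)
  have "(1 - q ^ Suc n) * (a * q ^ n * U_coeff n k)
      = (1 - q ^ Suc n) * U_coeff n j - (1 - q ^ Suc n) * U_coeff (Suc n) k"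
    unfolding Suc U_coeff_pascal by (simp add: algebra_simps)
  also have "\<dots> = (1 - q ^ k) * U_coeff (Suc n) k - (1 - q ^ Suc n) * U_coeff (Suc n) k"
    unfolding Suc U_coeff_descend ..
  finally show ?thesis by (simp add: algebra_simps)
qed

lemma U_ascend:
  "(1 - q ^ Suc n) * (a * q ^ n * poly (U n) x)
    = (\<Sum>k\<le>Suc n. (q ^ Suc n - q ^ k) * (U_coeff (Suc n) k * poly (shifted_basis k) x))"
proof -
  have "(1 - q ^ Suc n) * (a * q ^ n * poly (U n) x)
      = (\<Sum>k\<le>Suc n. ((1 - q ^ Suc n) * (a * q ^ n * U_coeff n k)) * poly (shifted_basis k) x)"
    unfolding U_expansion_Suc poly_sum poly_smult sum_distrib_left by (simp only: mult.assoc)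
  then show ?thesis
    unfolding U_coeff_ascend by (simp only: mult.assoc)
qed

lemma poly_shifted_basis:
  assumes "x \<noteq> 0"
  shows "poly (shifted_basis k) x = x ^ k * qpoch (1 / x) q k"
proof -
  have "poly (shifted_basis k) x = (\<Prod>j<k. x * (1 - 1 / x * q ^ j))"
    unfolding shifted_basis_def poly_prod using assms by (intro prod.cong) (auto simp: field_simps)
  then show ?thesis by (simp add: prod.distrib qpoch_def)
qed

text \<open>Multiplying the parameter by \<open>q\<close> drops the first factor and appends one.\<close>

lemma qpoch_ratio:
  assumes "b \<noteq> 1" "qpoch b q k \<noteq> 0"
  shows "qpoch (b * q) q k / qpoch b q k = (1 - b * q ^ k) / (1 - b)"
  using qpoch_rec_left[of b q k] qpoch_Suc[of b q k] assms by (simp add: field_simps)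

text \<open>The parameter pair \<open>\<phi>\<close> over \<open>\<phi>/q\<close> multiplies the \<open>k\<close>-th term of the \<open>2\<phi>1\<close>-series of \<open>U n\<close> by
  a linear function of \<open>q^k\<close>.\<close>

lemma qhyp_3phi2:
  assumes "x \<noteq> 0" and nz: "\<And>j. j < n \<Longrightarrow> \<phi> / q * q ^ j \<noteq> 1" and "n \<ge> 1"
  shows "(-a) ^ n * q ^ (n choose 2) * (1 - \<phi> / q)
      * qhyp [q powi (- int n), 1 / x, \<phi>] [0, \<phi> / q] q (q * x / a)
    = (\<Sum>k\<le>n. (1 - \<phi> / q * q ^ k) * (U_coeff n k * poly (shifted_basis k) x))"
proof -
  let ?t = "\<lambda>k. qpoch (q powi (- int n)) q k * qpoch (1 / x) q k * qpoch \<phi> q k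
    / qpoch (\<phi> / q) q k * ((q * x / a) ^ k / qpoch q q k)"
  have "qhyp [q powi (- int n), 1 / x, \<phi>] [0, \<phi> / q] q (q * x / a) = (\<Sum>k. ?t k)"
    by (simp add: qhyp_def qpochs_def qpoch_def[of 0] mult.assoc)
  also have "\<dots> = (\<Sum>k\<le>n. ?t k)"
    using q_pos by (intro suminf_finite) (auto simp: qpoch_neg_power_eq_0)
  finally have "(-a) ^ n * q ^ (n choose 2) * (1 - \<phi> / q)
      * qhyp [q powi (- int n), 1 / x, \<phi>] [0, \<phi> / q] q (q * x / a)
    = (\<Sum>k\<le>n. (-a) ^ n * q ^ (n choose 2) * (1 - \<phi> / q) * ?t k)"
    by (simp only: sum_distrib_left)
  also have "\<dots> = (\<Sum>k\<le>n. (1 - \<phi> / q * q ^ k) * (U_coeff n k * poly (shifted_basis k) x))"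
  proof (intro sum.cong refl)
    fix k assume "k \<in> {..n}"
    then have "qpoch (\<phi> / q) q k \<noteq> 0"
      using nz by (auto simp: qpoch_def)
    moreover have ne1: "\<phi> / q \<noteq> 1"
      using nz[of 0] \<open>n \<ge> 1\<close> by simp
    ultimately have "qpoch \<phi> q k / qpoch (\<phi> / q) q k = (1 - \<phi> / q * q ^ k) / (1 - \<phi> / q)"
      using qpoch_ratio[of "\<phi> / q" k] q_pos by simp
    then have "(1 - \<phi> / q) * (qpoch \<phi> q k / qpoch (\<phi> / q) q k) = 1 - \<phi> / q * q ^ k"
      using ne1 by simp
    moreover have "(-a) ^ n * q ^ (n choose 2) * (1 - \<phi> / q) * ?t k
        = ((1 - \<phi> / q) * (qpoch \<phi> q k / qpoch (\<phi> / q) q k)) *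
          ((-a) ^ n * q ^ (n choose 2) * qpoch (q powi (- int n)) q k * qpoch (1 / x) q k
            * ((q * x / a) ^ k / qpoch q q k))"
      by (simp only: times_divide_eq_left times_divide_eq_right divide_divide_eq_left mult_ac)
    moreover have "(-a) ^ n * q ^ (n choose 2) * qpoch (q powi (- int n)) q k * qpoch (1 / x) q k
            * ((q * x / a) ^ k / qpoch q q k) = U_coeff n k * poly (shifted_basis k) x"
      unfolding U_coeff_def poly_shifted_basis[OF \<open>x \<noteq> 0\<close>] power_mult_distrib power_divide
      by (simp add: mult_ac)
    ultimately show "(-a) ^ n * q ^ (n choose 2) * (1 - \<phi> / q) * ?t k
        = (1 - \<phi> / q * q ^ k) * (U_coeff n k * poly (shifted_basis k) x)"
      by (simp only:)
  qed
  finally show ?thesis .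
qed

text \<open>The left-hand side is \<open>q / \<phi>\<close>; this form shows that \<open>\<phi>\<close> is chosen so that the \<open>k\<close>-th
  coefficient of \<open>A U (n + 1) + B U n\<close> is that of \<open>U (n + 1)\<close> times a constant multiple of
  \<open>q / \<phi> - q^k\<close>.\<close>

lemma sob_phi_inverse:
  assumes "sob_B q a \<alpha> N (Suc n) x \<noteq> 0"
  shows "q * ((1 - q) * sob_Theta q a \<alpha> N (Suc n) x + 1)
    = a * q ^ n * (1 - q ^ Suc n) * sob_A q a \<alpha> N (Suc n) x / sob_B q a \<alpha> N (Suc n) x + q ^ Suc n"
proof -
  have "q * q powi (int (Suc n) - 2) = q ^ n"
    using q_pos by (simp add: power_int_diff power2_eq_square)
  moreover have "q * ((1 - q) * (a * p * s * A / B - t) + 1)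
      = a * (q * p) * ((1 - q) * s) * A / B - q * ((1 - q) * t) + q" for p s t A B
    by (simp add: algebra_simps)
  moreover have "qnum q (int (Suc n) - 1) = qnum q (int n)" by simp
  ultimately show ?thesis
    unfolding sob_Theta_def using qnum_mult[of "Suc n"] qnum_mult[of n]
    by (simp only:) (simp add: algebra_simps)
qed

end

theorem theorem3:
  fixes q a \<alpha> N x \<phi> :: real and n :: nat
  assumes "0 < q" "q < 1" "a < 0" "N \<ge> 0" "n \<ge> 1"
    and "\<phi> = sob_phi q a \<alpha> N n x"
    and "x \<noteq> 0" "x \<noteq> \<alpha>" "x \<noteq> \<alpha> * q"
    and "sob_B q a \<alpha> N n x \<noteq> 0"
    and "(1 - q) * sob_Theta q a \<alpha> N n x + 1 \<noteq> 0"
    and "\<forall>j<n. \<phi> * q powi (int j - 1) \<noteq> 1"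
  shows "poly (asc_sobolev q a \<alpha> N n) x =
    (-a) ^ n
      * (sob_B q a \<alpha> N n x * (1 - \<phi> / q) * q powi (int (n choose 2) - int n + 2)
          / (a * qnum q (int n) * \<phi> * (1 - q)))
      * qhyp [q powi (- int n), 1 / x, \<phi>] [0, \<phi> / q] q (q * x / a)"
proof -
  interpret al_salam_carlitz q a
    using assms by unfold_locales
  obtain m where n: "n = Suc m"
    using \<open>n \<ge> 1\<close> by (cases n) auto
  define A where "A = sob_A q a \<alpha> N n x"
  define B where "B = sob_B q a \<alpha> N n x"
  define H where "H = qhyp [q powi (- int n), 1 / x, \<phi>] [0, \<phi> / q] q (q * x / a)"
  define T where "T k = U_coeff n k * poly (shifted_basis k) x" for k
  define c where "c = a * q ^ m * (1 - q ^ n)"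
  have c: "c \<noteq> 0"
    using q_pos a_neg q_power_neq_1[of m] by (simp add: c_def n)
  have B: "B \<noteq> 0" and \<phi>: "\<phi> \<noteq> 0"
    using assms by (simp_all add: B_def sob_phi_def)
  \<comment> \<open>The definition of \<open>\<phi>\<close>, solved for the linear function of \<open>q ^ k\<close> that appears below.\<close>
  have inv: "q / \<phi> = c * A / B + q ^ n"
    using sob_phi_inverse[of \<alpha> N m x] assms(6,10) by (simp add: n sob_phi_def c_def A_def B_def mult_ac)
  have nz: "\<phi> / q * q ^ j \<noteq> 1" if "j < n" for j
    using assms(12) that q_pos by (simp add: power_int_diff)
  have "c * poly (U m) x = (\<Sum>k\<le>n. (q ^ n - q ^ k) * T k)"
    using U_ascend[of m x] by (simp add: n T_def c_def mult_ac)
  moreover have "poly (U n) x = (\<Sum>k\<le>n. T k)"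
    by (simp add: U_expansion poly_sum T_def)
  \<comment> \<open>Expand both polynomials over the terms \<open>T k\<close> and factor out \<open>B q / \<phi>\<close>.\<close>
  ultimately have "c * (A * poly (U n) x + B * poly (U m) x)
      = (\<Sum>k\<le>n. c * A * T k + B * ((q ^ n - q ^ k) * T k))"
    unfolding sum.distrib sum_distrib_left[symmetric] by (simp add: algebra_simps)
  also have "\<dots> = (\<Sum>k\<le>n. (B * q / \<phi>) * ((1 - \<phi> / q * q ^ k) * T k))"
  proof (intro sum.cong refl)
    fix k
    have "c * A = B * (q / \<phi> - q ^ n)"
      using B by (simp add: inv)
    then have "c * A + B * (q ^ n - q ^ k) = (B * q / \<phi>) * (1 - \<phi> / q * q ^ k)"
      using \<phi> q_pos by (simp add: field_simps)
    then show "c * A * T k + B * ((q ^ n - q ^ k) * T k)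
        = (B * q / \<phi>) * ((1 - \<phi> / q * q ^ k) * T k)"
      by (metis distrib_right mult.assoc)
  qed
  also have "\<dots> = (B * q / \<phi>) * ((-a) ^ n * q ^ (n choose 2) * (1 - \<phi> / q) * H)"
    unfolding T_def sum_distrib_left[symmetric] H_def
    using qhyp_3phi2[OF \<open>x \<noteq> 0\<close> nz \<open>n \<ge> 1\<close>] by simp
  finally have sum_eq: "A * poly (U n) x + B * poly (U m) x
      = (B * q / \<phi>) * ((-a) ^ n * q ^ (n choose 2) * (1 - \<phi> / q) * H) / c"
    using c by (metis nonzero_mult_div_cancel_left)
  have conn: "poly (asc_sobolev q a \<alpha> N n) x = A * poly (U n) x + B * poly (U m) x"
    unfolding asc_sobolev_eq[OF \<open>N \<ge> 0\<close>] A_def B_def n using assms(8,9) by (rule sobolev_connection)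
  have expo: "q powi (int (n choose 2) - int n + 2) = q ^ (n choose 2) * q / q ^ m"
    using q_pos by (simp add: n power_int_diff power_int_add power2_eq_square)
  have denom: "a * qnum q (int n) * \<phi> * (1 - q) = a * \<phi> * (1 - q ^ n)"
    unfolding qnum_mult[of n, symmetric] by (simp add: mult_ac)
  show ?thesis
    unfolding H_def[symmetric] B_def[symmetric] conn sum_eq expo denom c_def
    by (simp only: times_divide_eq_left times_divide_eq_right divide_divide_eq_left mult_ac)
qed

end
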